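(* Let $C$ be a cyclically ordered graph with at least one edge. Then $ssat_{\circlearrowright}(n,C)=O(1)$ if $C$ contains a minedge, and $ssat_{\circlearrowright}(n,C)=\Theta(n)$ otherwise.
   Context: A cyclically ordered graph is a finite simple graph whose vertex set is cyclically ordered. For vertices $u,x,v$ write $u<x<v$ if going clockwise from $u$ one meets $x$ before $v$; $I_{u,v}=\{x:u<x<v\}$. A copy of $C$ in $H$ is given by an injective cyclic-order-preserving map $\varphi:V(C)\to V(H)$ with $\varphi(u)\varphi(v)\in E(H)$ for all $uv\in E(C)$. $H$ semisaturates $C$ if for every pair of distinct non-adjacent vertices $x,y$ of $H$, $H+xy$ contains a copy of $C$ not contained in $H$. $ssat_{\circlearrowright}(n,C)$ is the minimum number of edges of a cyclically ordered graph on $n$ vertices semisaturating $C$. An edge $uv$ of $C$ is a minedge if $I_{u,v}$ or $I_{v,u}$ is empty and both $u,v$ have degree one. *)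

theory Defs
  imports Complex_Main "HOL-Library.Landau_Symbols"
begin

record 'a cograph =
  verts :: "'a set"
  edges :: "'a set set"
  cyc :: "'a \<Rightarrow> 'a \<Rightarrow> 'a \<Rightarrow> bool"

text \<open>
  The value \<open>R u x v\<close> means \<open>u < x < v\<close>: going clockwise from \<open>u\<close> one meets \<open>x\<close> before \<open>v\<close>.
  The axioms are those of a total strict cyclic order; they force \<open>u\<close>, \<open>x\<close>, \<open>v\<close> to be distinct.
\<close>
definition cyclic_order_on :: "'a set \<Rightarrow> ('a \<Rightarrow> 'a \<Rightarrow> 'a \<Rightarrow> bool) \<Rightarrow> bool" where
  "cyclic_order_on V R \<longleftrightarrow>
     (\<forall>a b c. R a b c \<longrightarrow> a \<in> V \<and> b \<in> V \<and> c \<in> V) \<and>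
     (\<forall>a b c. R a b c \<longrightarrow> R b c a) \<and>
     (\<forall>a b c. R a b c \<longrightarrow> \<not> R c b a) \<and>
     (\<forall>a b c d. R a b c \<longrightarrow> R a c d \<longrightarrow> R a b d) \<and>
     (\<forall>a\<in>V. \<forall>b\<in>V. \<forall>c\<in>V. a \<noteq> b \<longrightarrow> b \<noteq> c \<longrightarrow> a \<noteq> c \<longrightarrow> R a b c \<or> R c b a)"

definition cyc_ordered_graph :: "'a cograph \<Rightarrow> bool" where
  "cyc_ordered_graph G \<longleftrightarrow>
     finite (verts G) \<and>
     (\<forall>e\<in>edges G. e \<subseteq> verts G \<and> card e = 2) \<and>
     cyclic_order_on (verts G) (cyc G)"

definition interval :: "'a cograph \<Rightarrow> 'a \<Rightarrow> 'a \<Rightarrow> 'a set" where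
  "interval G u v = {x \<in> verts G. cyc G u x v}"

definition degree :: "'a cograph \<Rightarrow> 'a \<Rightarrow> nat" where
  "degree G v = card {e \<in> edges G. v \<in> e}"

definition minedge :: "'a cograph \<Rightarrow> 'a \<Rightarrow> 'a \<Rightarrow> bool" where
  "minedge G u v \<longleftrightarrow>
     {u, v} \<in> edges G \<and> (interval G u v = {} \<or> interval G v u = {}) \<and>
     degree G u = 1 \<and> degree G v = 1"

definition copy_in :: "('a \<Rightarrow> 'b) \<Rightarrow> 'a cograph \<Rightarrow> 'b cograph \<Rightarrow> bool" where
  "copy_in \<phi> C H \<longleftrightarrow>
     \<phi> ` verts C \<subseteq> verts H \<and> inj_on \<phi> (verts C) \<and>
     (\<forall>u\<in>verts C. \<forall>x\<in>verts C. \<forall>v\<in>verts C. cyc C u x v \<longrightarrow> cyc H (\<phi> u) (\<phi> x) (\<phi> v)) \<and>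
     (\<forall>u v. {u, v} \<in> edges C \<longrightarrow> {\<phi> u, \<phi> v} \<in> edges H)"

definition add_edge :: "'a cograph \<Rightarrow> 'a \<Rightarrow> 'a \<Rightarrow> 'a cograph" where
  "add_edge H x y = H\<lparr>edges := insert {x, y} (edges H)\<rparr>"

definition semisaturates :: "'b cograph \<Rightarrow> 'a cograph \<Rightarrow> bool" where
  "semisaturates H C \<longleftrightarrow>
     (\<forall>x\<in>verts H. \<forall>y\<in>verts H. x \<noteq> y \<longrightarrow> {x, y} \<notin> edges H \<longrightarrow>
        (\<exists>\<phi>. copy_in \<phi> C (add_edge H x y) \<and> \<not> copy_in \<phi> C H))"

text \<open>
  Every cyclically ordered graph on \<open>n\<close> vertices is isomorphic to one whose vertices are natural
  numbers, so it suffices to let the host graph range over \<^typ>\<open>nat cograph\<close>.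
\<close>
definition ssat :: "nat \<Rightarrow> 'a cograph \<Rightarrow> nat" where
  "ssat n C = (LEAST m. \<exists>H :: nat cograph.
     cyc_ordered_graph H \<and> card (verts H) = n \<and> semisaturates H C \<and> card (edges H) = m)"

text \<open>The minimum is over a nonempty set: complete graphs are vacuously semisaturated.\<close>
lemma ssat_attained:
  "\<exists>H :: nat cograph. cyc_ordered_graph H \<and> card (verts H) = n \<and> semisaturates H C \<and>
     card (edges H) = ssat n C"
proof -
  define H :: "nat cograph" where
    "H = \<lparr>verts = {..<n}, edges = {e. e \<subseteq> {..<n} \<and> card e = 2},
          cyc = (\<lambda>a b c. a < n \<and> b < n \<and> c < n \<and>
                   (a < b \<and> b < c \<or> b < c \<and> c < a \<or> c < a \<and> a < b))\<rparr>"
  have "cyc_ordered_graph H"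
    unfolding cyc_ordered_graph_def cyclic_order_on_def H_def by auto
  moreover have "card (verts H) = n"
    by (simp add: H_def)
  moreover have "semisaturates H C"
    unfolding semisaturates_def H_def by auto
  ultimately have "\<exists>m. \<exists>H :: nat cograph.
     cyc_ordered_graph H \<and> card (verts H) = n \<and> semisaturates H C \<and> card (edges H) = m"
    by blast
  from LeastI_ex[OF this] show ?thesis
    unfolding ssat_def .
qed

end

theory Submission imports Defs begin

text \<open>
  Lower bound: if two cyclically consecutive vertices \<open>x\<close>, \<open>y\<close> of the host are isolated, then the
  copy of \<open>C\<close> created by the edge \<open>xy\<close> exhibits a minedge. Hence without minedges the cyclic
  successor maps isolated vertices injectively to non-isolated ones, and a host with \<open>m\<close> edges has
  at most \<open>4m\<close> vertices.

  Upper bounds: let \<open>k\<close> be the number of vertices of \<open>C\<close>. Make the first \<open>k\<close> vertices of the host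
  \<open>{..<n}\<close> universal, and join any two vertices at distance at most \<open>k\<close>. If \<open>uv\<close> is an edge of \<open>C\<close>
  with \<open>I\<^bsub>u,v\<^esub>\<close> of least size, no edge other than \<open>uv\<close> lies within \<open>I\<^bsub>u,v\<^esub> \<union> {u, v}\<close>. For a missing
  edge \<open>xy\<close> with \<open>x < y\<close>, send \<open>u\<close>, \<open>v\<close> to \<open>x\<close>, \<open>y\<close>, the interval \<open>I\<^bsub>v,u\<^esub>\<close> to universal vertices,
  and \<open>I\<^bsub>u,v\<^esub>\<close> anywhere between \<open>x\<close> and \<open>y\<close>. If \<open>uv\<close> is a minedge, a clique on the first \<open>2k\<close>
  vertices is enough, since \<open>k\<close> of them lie on one side of any \<open>x\<close>.
\<close>

section \<open>Cyclic orders\<close>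

lemma
  assumes "cyclic_order_on V R"
  shows cyclic_in: "R a b c \<Longrightarrow> a \<in> V \<and> b \<in> V \<and> c \<in> V"
    and cyclic_rot: "R a b c \<Longrightarrow> R b c a"
    and cyclic_asym: "R a b c \<Longrightarrow> \<not> R c b a"
    and cyclic_trans: "R a b c \<Longrightarrow> R a c d \<Longrightarrow> R a b d"
    and cyclic_total: "\<lbrakk>a \<in> V; b \<in> V; c \<in> V; a \<noteq> b; b \<noteq> c; a \<noteq> c\<rbrakk> \<Longrightarrow> R a b c \<or> R c b a"
  using assms unfolding cyclic_order_on_def by (elim conjE, meson)+

text \<open>A triple with a repeated entry has its own reversal among its rotations, which asymmetry
  forbids.\<close>

lemma cyclic_distinct:
  assumes "cyclic_order_on V R" "R a b c"
  shows "a \<noteq> b \<and> b \<noteq> c \<and> a \<noteq> c"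
  using assms cyclic_rot[OF assms(1)] cyclic_asym[OF assms(1)] by metis

text \<open>No vertex set is attached, so that embeddings can be built without mentioning the host
  size; \<open>host\<close> adds the bound.\<close>

definition nat_cyclic :: "nat \<Rightarrow> nat \<Rightarrow> nat \<Rightarrow> bool" where
  "nat_cyclic a b c \<longleftrightarrow> a < b \<and> b < c \<or> b < c \<and> c < a \<or> c < a \<and> a < b"

text \<open>Cutting a cyclic order at \<open>v\<close> gives a linear order with last element \<open>v\<close>.\<close>

lemma cyclic_cut:
  assumes V: "cyclic_order_on V R"
    and mono: "\<And>a b. R a b v \<Longrightarrow> f a < f b"
    and last: "\<And>a. a \<in> V \<Longrightarrow> a \<noteq> v \<Longrightarrow> f a < f v"
    and "v \<in> V"
  shows "R a b c \<Longrightarrow> nat_cyclic (f a) (f b) (f c)" and "inj_on f V"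
proof -
  note rot = cyclic_rot[OF V] and asym = cyclic_asym[OF V] and tr = cyclic_trans[OF V]
    and tot = cyclic_total[OF V] and inV = cyclic_in[OF V]
  have less: "f a < f b \<or> f b < f a" if "a \<in> V" "b \<in> V" "a \<noteq> b" for a b
    using tot[of a b v] mono[of a b] mono[of b a] last[of a] last[of b] rot that \<open>v \<in> V\<close> by metis
  then show "inj_on f V"
    unfolding inj_on_def by (metis less_irrefl)
  have less_iff: "f a < f b \<longleftrightarrow> R a b v" if "a \<in> V" "b \<in> V" "a \<noteq> v" "b \<noteq> v" for a b
    using tot[of a b v] mono[of a b] mono[of b a] rot that \<open>v \<in> V\<close>
    by (metis less_asym less_irrefl)
  assume R: "R a b c"
  have mem: "a \<in> V" "b \<in> V" "c \<in> V" and ne: "a \<noteq> b" "b \<noteq> c" "a \<noteq> c"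
    using inV[OF R] cyclic_distinct[OF V R] by auto
  have R': "R b c a" "R c a b" using R rot by blast+
  consider "a = v" | "b = v" | "c = v" | "a \<noteq> v" "b \<noteq> v" "c \<noteq> v" by blast
  then show "nat_cyclic (f a) (f b) (f c)"
  proof cases
    case 4
    \<comment> \<open>Distinct values that are out of cyclic order decrease along some rotation of
      the triple. Decreasing values put z before y and y before x in the cut at v, while rotating
      \<open>R x y z\<close> and transitivity put y before z.\<close>
    have no: False if "R x y z" "f z < f y" "f y < f x" "x \<noteq> v" "y \<noteq> v" "z \<noteq> v" for x y z
    proof -
      have "R z y v" "R y x v" using less_iff inV[OF that(1)] that by auto
      moreover have "R y z v" using tr[of y z x v] rot[OF that(1)] \<open>R y x v\<close> by blast
      ultimately show False using rot asym by blast
    qed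
    show ?thesis
      using less[OF mem(1,2) ne(1)] less[OF mem(2,3) ne(2)] less[OF mem(1,3) ne(3)]
        no[OF R] no[OF R'(1)] no[OF R'(2)] 4
      unfolding nat_cyclic_def by blast
  qed (use R R' mono last mem ne in \<open>auto simp: nat_cyclic_def\<close>)
qed

text \<open>By transitivity both smaller intervals lie in \<open>interval G u v\<close>, and w is in
  the latter only. Thus the size of the interval from a fixed start is a strictly increasing
  coordinate; the embeddings below are built from it.\<close>

lemma interval_card_less:
  assumes G: "cyc_ordered_graph G"
    and "cyc G u w v"
  shows "card (interval G u w) < card (interval G u v)"
    and "card (interval G w v) < card (interval G u v)"
proof -
  have V: "cyclic_order_on (verts G) (cyc G)" and fin: "finite (interval G u v)"
    using G by (auto simp: cyc_ordered_graph_def interval_def)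
  note rot = cyclic_rot[OF V] and tr = cyclic_trans[OF V] and inV = cyclic_in[OF V]
  have w: "w \<in> interval G u v"
    using assms inV by (auto simp: interval_def)
  have "interval G u w \<subseteq> interval G u v" "interval G w v \<subseteq> interval G u v"
    using tr rot assms(2) unfolding interval_def by blast+
  moreover have "w \<notin> interval G u w" "w \<notin> interval G w v"
    using cyclic_distinct[OF V] by (auto simp: interval_def)
  ultimately have "interval G u w \<subset> interval G u v" "interval G w v \<subset> interval G u v"
    using w by auto
  then show "card (interval G u w) < card (interval G u v)"
    "card (interval G w v) < card (interval G u v)"
    using fin psubset_card_mono by blast+
qed

lemma interval_card_less_verts:
  assumes G: "cyc_ordered_graph G" and "u \<in> verts G"
  shows "card (interval G u w) < card (verts G)"
proof (rule psubset_card_mono)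
  have V: "cyclic_order_on (verts G) (cyc G)" using G by (auto simp: cyc_ordered_graph_def)
  show "finite (verts G)" using G by (auto simp: cyc_ordered_graph_def)
  have "u \<notin> interval G u w" using cyclic_distinct[OF V] by (auto simp: interval_def)
  then show "interval G u w \<subset> verts G" using assms by (auto simp: interval_def)
qed

lemma cyc_graph_edge:
  assumes "cyc_ordered_graph G" "{a, b} \<in> edges G"
  shows "a \<noteq> b" "a \<in> verts G" "b \<in> verts G"
proof -
  have "card {a, b} = 2" and "{a, b} \<subseteq> verts G"
    using assms by (auto simp: cyc_ordered_graph_def)
  then show "a \<noteq> b" "a \<in> verts G" "b \<in> verts G" by auto
qed

section \<open>Lower bound\<close>

text \<open>Take y with the smallest interval from x: a vertex strictly between would have a smaller
  one.\<close>

lemma cyclic_successor: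
  assumes G: "cyc_ordered_graph G" and "x \<in> verts G" "card (verts G) \<ge> 2"
  shows "\<exists>y\<in>verts G. y \<noteq> x \<and> interval G x y = {}"
proof -
  have V: "cyclic_order_on (verts G) (cyc G)" using G by (auto simp: cyc_ordered_graph_def)
  have "\<exists>y. y \<in> verts G \<and> y \<noteq> x"
  proof (rule ccontr)
    assume "\<not> ?thesis"
    then have "verts G \<subseteq> {x}" by blast
    then have "card (verts G) \<le> card {x}" by (intro card_mono) auto
    then show False using assms by simp
  qed
  then obtain y where y: "y \<in> verts G" "y \<noteq> x"
    and min: "\<And>z. z \<in> verts G \<and> z \<noteq> x \<Longrightarrow> card (interval G x y) \<le> card (interval G x z)"
    using ex_has_least_nat[where P = "\<lambda>y. y \<in> verts G \<and> y \<noteq> x"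
        and m = "\<lambda>y. card (interval G x y)"] by metis
  have "\<not> cyc G x z y" for z
    using interval_card_less(1)[OF G, of x z y] min[of z] cyclic_in[OF V, of x z y]
      cyclic_distinct[OF V, of x z y] by auto
  then show ?thesis using y by (auto simp: interval_def)
qed

lemma degree_eq_1I:
  assumes G: "cyc_ordered_graph G" and "{u, v} \<in> edges G"
    and only: "\<And>w. {u, w} \<in> edges G \<Longrightarrow> w = v"
  shows "degree G u = 1"
proof -
  have "e = {u, v}" if "e \<in> edges G" "u \<in> e" for e
  proof -
    have "card e = 2" using G that by (auto simp: cyc_ordered_graph_def)
    then obtain a b where "e = {a, b}" by (auto simp: card_2_iff)
    then obtain w where "e = {u, w}" using \<open>u \<in> e\<close> by blast
    then show ?thesis using only that by blast
  qed
  then have "{e \<in> edges G. u \<in> e} = {{u, v}}" using assms(2) by blast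
  then show ?thesis by (simp add: degree_def)
qed

text \<open>In the host with xy added, xy is the only edge at x and at y, so the edge of C mapped
  onto it has ends of degree one. A vertex of C between these ends would be mapped between x and
  y.\<close>

lemma isolated_consecutive_minedge:
  assumes C: "cyc_ordered_graph C" and H: "semisaturates H C"
    and xy: "x \<in> verts H" "y \<in> verts H" "x \<noteq> y"
    and iso: "x \<notin> \<Union>(edges H)" "y \<notin> \<Union>(edges H)"
    and empty: "interval H x y = {}"
  shows "\<exists>u v. minedge C u v"
proof -
  have V: "cyclic_order_on (verts C) (cyc C)" using C by (auto simp: cyc_ordered_graph_def)
  have "{x, y} \<notin> edges H" using iso by auto
  then obtain f where f: "copy_in f C (add_edge H x y)" "\<not> copy_in f C H"
    using H xy unfolding semisaturates_def by blast
  have inj: "inj_on f (verts C)" and fV: "f ` verts C \<subseteq> verts H"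
    and fR: "\<And>u w v. cyc C u w v \<Longrightarrow> cyc H (f u) (f w) (f v)"
    and fE: "\<And>u v. {u, v} \<in> edges C \<Longrightarrow> {f u, f v} = {x, y} \<or> {f u, f v} \<in> edges H"
    using f(1) cyclic_in[OF V] unfolding copy_in_def add_edge_def by auto
  \<comment> \<open>Adding xy changes neither vertices nor order, so f can fail to be a copy in H
    only at an edge.\<close>
  obtain a b where ab: "{a, b} \<in> edges C" "{f a, f b} \<notin> edges H"
    using f unfolding copy_in_def add_edge_def by auto
  then have "{f a, f b} = {x, y}" using fE by blast
  then obtain u v where uv: "{u, v} \<in> edges C" "f u = x" "f v = y"
    using ab by (metis doubleton_eq_iff insert_commute)
  have nb: "q = r" if "{p, q} \<in> edges C" "{p, r} \<in> edges C" "f p \<notin> \<Union>(edges H)" for p q r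
  proof -
    have "{f p, f q} = {x, y}" "{f p, f r} = {x, y}" using fE that by blast+
    then have "f q = f r" by (metis doubleton_eq_iff)
    then show ?thesis using inj that cyc_graph_edge[OF C] by (meson inj_onD)
  qed
  have vu: "{v, u} \<in> edges C" using uv by (simp add: insert_commute)
  have "degree C u = 1" "degree C v = 1"
    using degree_eq_1I[OF C uv(1)] degree_eq_1I[OF C vu] nb uv vu iso by blast+
  moreover have "interval C u v = {}"
  proof -
    have False if "w \<in> interval C u v" for w
    proof -
      have "w \<in> verts C" "cyc C u w v" using that by (auto simp: interval_def)
      then have "f w \<in> interval H x y" using fR[of u w v] fV uv by (auto simp: interval_def)
      then show False using empty by simp
    qed
    then show ?thesis by blast
  qed
  ultimately show ?thesis using uv unfolding minedge_def by blast
qed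

text \<open>Each edge covers two vertices, and the isolated vertices are at most as many as the
  covered ones; this gives the factor 4. The bound on \<open>card (verts H)\<close> excludes the
  edgeless host with one vertex.\<close>

lemma no_minedge_card_verts_le:
  assumes C: "cyc_ordered_graph C" and no: "\<not> (\<exists>u v. minedge C u v)"
    and H: "cyc_ordered_graph H" "semisaturates H C" and "card (verts H) \<ge> 2"
  shows "card (verts H) \<le> 4 * card (edges H)"
proof -
  have V: "cyclic_order_on (verts H) (cyc H)" and finV: "finite (verts H)"
    using H by (auto simp: cyc_ordered_graph_def)
  define W where "W = \<Union>(edges H)"
  have WV: "W \<subseteq> verts H" using H(1) unfolding W_def cyc_ordered_graph_def by blast
  have "card W \<le> sum card (edges H)"
    unfolding W_def by (rule card_Union_le_sum_card)
  also have "\<dots> = 2 * card (edges H)"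
    using H(1) by (simp add: cyc_ordered_graph_def)
  finally have W: "card W \<le> 2 * card (edges H)" .
  have "\<exists>s. \<forall>x\<in>verts H. s x \<in> verts H \<and> s x \<noteq> x \<and> interval H x (s x) = {}"
    using cyclic_successor[OF H(1) _ assms(5)] by metis
  then obtain s where s: "\<And>x. x \<in> verts H \<Longrightarrow> s x \<in> verts H"
      "\<And>x. x \<in> verts H \<Longrightarrow> s x \<noteq> x" "\<And>x. x \<in> verts H \<Longrightarrow> interval H x (s x) = {}"
    by blast
  \<comment> \<open>Of two vertices with a common successor, one would lie between the other and
    that successor.\<close>
  have inj: "inj_on s (verts H)"
  proof (rule inj_onI, rule ccontr)
    fix x x' assume x: "x \<in> verts H" "x' \<in> verts H" "s x = s x'" "x \<noteq> x'"
    have "\<not> cyc H x x' (s x)" "\<not> cyc H x' x (s x)"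
      using s(3)[OF x(1)] s(3)[OF x(2)] x by (auto simp: interval_def)
    moreover have "cyc H x x' (s x) \<or> cyc H (s x) x' x"
      using cyclic_total[OF V, of x x' "s x"] s x by metis
    ultimately show False using cyclic_rot[OF V] by blast
  qed
  have "s ` (verts H - W) \<subseteq> W"
  proof (rule image_subsetI, rule ccontr)
    fix x assume "x \<in> verts H - W" "s x \<notin> W"
    then show False
      using isolated_consecutive_minedge[OF C H(2), of x "s x"] s no by (metis DiffE W_def)
  qed
  then have "card (verts H - W) \<le> card W"
    using inj WV finV by (meson Diff_subset card_inj_on_le finite_subset inj_on_subset)
  moreover have "card (verts H) = card (verts H - W) + card W"
    using WV finV by (metis card_Diff_subset card_mono finite_subset le_add_diff_inverse2)
  ultimately show ?thesis using W by linarith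
qed

section \<open>Upper bounds\<close>

text \<open>P is consulted only at pairs a < b, so it need not be symmetric.\<close>

definition host :: "nat \<Rightarrow> (nat \<Rightarrow> nat \<Rightarrow> bool) \<Rightarrow> nat cograph" where
  "host n P = \<lparr>verts = {..<n}, edges = {{a, b} |a b. a < b \<and> b < n \<and> P a b},
     cyc = (\<lambda>a b c. a < n \<and> b < n \<and> c < n \<and> nat_cyclic a b c)\<rparr>"

lemma host_simps [simp]:
  "verts (host n P) = {..<n}"
  "cyc (host n P) a b c \<longleftrightarrow> a < n \<and> b < n \<and> c < n \<and> nat_cyclic a b c"
  by (simp_all add: host_def)

lemma host_edge_iff:
  "a < b \<Longrightarrow> {a, b} \<in> edges (host n P) \<longleftrightarrow> b < n \<and> P a b"
  unfolding host_def by (auto simp: doubleton_eq_iff)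

lemma cyc_ordered_host: "cyc_ordered_graph (host n P)"
  unfolding cyc_ordered_graph_def cyclic_order_on_def host_def nat_cyclic_def by auto

text \<open>Reduces an upper bound to placing C for each missing pair x < y: some edge uv goes onto
  xy and all others onto pairs allowed by P. Such a copy is new because xy is missing from the
  host.\<close>

lemma ssat_le_host:
  assumes C: "cyc_ordered_graph C"
    and copy: "\<And>x y. \<lbrakk>x < y; y < n; \<not> P x y\<rbrakk> \<Longrightarrow>
      \<exists>u v f. {u, v} \<in> edges C \<and> f u = x \<and> f v = y \<and> inj_on f (verts C) \<and>
        f ` verts C \<subseteq> {..y} \<and>
        (\<forall>a b c. cyc C a b c \<longrightarrow> nat_cyclic (f a) (f b) (f c)) \<and>
        (\<forall>a b. {a, b} \<in> edges C \<longrightarrow> {a, b} \<noteq> {u, v} \<longrightarrow> f a < f b \<longrightarrow> P (f a) (f b))"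
  shows "ssat n C \<le> card (edges (host n P))"
proof -
  have step: "\<exists>f. copy_in f C (add_edge (host n P) x y) \<and> \<not> copy_in f C (host n P)"
    if xy: "x < y" "y < n" "{x, y} \<notin> edges (host n P)" for x y
  proof -
    have "\<not> P x y" using xy by (simp add: host_edge_iff)
    from copy[OF xy(1,2) this] obtain u v f where uv: "{u, v} \<in> edges C" "f u = x" "f v = y"
      and inj: "inj_on f (verts C)" and f: "f ` verts C \<subseteq> {..y}"
      and R: "\<forall>a b c. cyc C a b c \<longrightarrow> nat_cyclic (f a) (f b) (f c)"
      and E: "\<forall>a b. {a, b} \<in> edges C \<longrightarrow> {a, b} \<noteq> {u, v} \<longrightarrow> f a < f b \<longrightarrow> P (f a) (f b)"
      by (elim exE conjE) (rule that)
    have fn: "f a < n" if "a \<in> verts C" for a using f that \<open>y < n\<close> by force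
    have up: "{f a, f b} \<in> edges (host n P)"
      if "{a, b} \<in> edges C" "{a, b} \<noteq> {u, v}" "f a < f b" for a b
      using host_edge_iff[OF that(3)] E that fn cyc_graph_edge[OF C that(1)] by blast
    have edge: "{f a, f b} \<in> edges (add_edge (host n P) x y)" if ab: "{a, b} \<in> edges C" for a b
    proof (cases "{a, b} = {u, v}")
      case True
      then have "{f a, f b} = {x, y}" using uv by (auto simp: doubleton_eq_iff)
      then show ?thesis by (simp add: add_edge_def)
    next
      case False
      have "{b, a} = {a, b}" "{f b, f a} = {f a, f b}" by blast+
      moreover have "f a < f b \<or> f b < f a"
        using cyc_graph_edge[OF C ab] inj by (meson inj_onD linorder_neqE_nat)
      ultimately have "{f a, f b} \<in> edges (host n P)"
        using up[of a b] up[of b a] ab False by auto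
      then show ?thesis by (simp add: add_edge_def)
    qed
    have "copy_in f C (add_edge (host n P) x y)"
      unfolding copy_in_def
    proof (intro conjI ballI allI impI)
      show "f ` verts C \<subseteq> verts (add_edge (host n P) x y)" using fn by (auto simp: add_edge_def)
    qed (use inj fn R edge in \<open>auto simp: add_edge_def\<close>)
    moreover have "\<not> copy_in f C (host n P)"
      using uv xy unfolding copy_in_def by blast
    ultimately show ?thesis by blast
  qed
  have "semisaturates (host n P) C"
    unfolding semisaturates_def
  proof (intro ballI impI)
    fix x y assume "x \<in> verts (host n P)" "y \<in> verts (host n P)" "x \<noteq> y" "{x, y} \<notin> edges (host n P)"
    then show "\<exists>f. copy_in f C (add_edge (host n P) x y) \<and> \<not> copy_in f C (host n P)"
      using step[of x y] step[of y x] by (cases "x < y") (auto simp: insert_commute add_edge_def)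
  qed
  then show ?thesis
    unfolding ssat_def using cyc_ordered_host[of n P] by (intro Least_le exI[of _ "host n P"]) simp
qed

text \<open>Cut after v, the order of C reads \<open>interval C v u\<close>, u,
  \<open>interval C u v\<close>, v. The first block is placed below \<open>card (verts C)\<close> by
  sizes counted from v, the second right after x by sizes counted from u; the bounds on x and y
  leave room for both.\<close>

lemma embed_linear:
  assumes C: "cyc_ordered_graph C" and uv: "u \<in> verts C" "v \<in> verts C" "u \<noteq> v"
    and x: "card (verts C) \<le> x" and y: "x + card (interval C u v) < y"
  shows "\<exists>f. f u = x \<and> f v = y \<and> inj_on f (verts C) \<and> f ` verts C \<subseteq> {..y} \<and>
     (\<forall>a b c. cyc C a b c \<longrightarrow> nat_cyclic (f a) (f b) (f c)) \<and>
     (\<forall>w\<in>verts C. w \<noteq> u \<and> w \<noteq> v \<and> w \<notin> interval C u v \<longrightarrow> f w < card (verts C))"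
proof -
  have V: "cyclic_order_on (verts C) (cyc C)" using C by (auto simp: cyc_ordered_graph_def)
  note rot = cyclic_rot[OF V] and asym = cyclic_asym[OF V] and tr = cyclic_trans[OF V]
    and inV = cyclic_in[OF V] and dist = cyclic_distinct[OF V]
  define f where "f w = (if w = u then x else if w = v then y
     else if cyc C u w v then x + 1 + card (interval C u w) else card (interval C v w))" for w
  have fu: "f u = x" and fv: "f v = y" using uv by (auto simp: f_def)
  have small: "card (interval C v w) < card (verts C)" for w
    using interval_card_less_verts[OF C uv(2)] .
  have mid: "card (interval C u w) < card (interval C u v)" if "cyc C u w v" for w
    using interval_card_less(1)[OF C that] .
  have mono: "f a < f b" if ab: "cyc C a b v" for a b
  proof -
    have ne: "a \<noteq> b" "a \<noteq> v" "b \<noteq> v" and mem: "a \<in> verts C" "b \<in> verts C"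
      using dist[OF ab] inV[OF ab] by auto
    consider "a = u" | "b = u" | "a \<noteq> u" "b \<noteq> u" "cyc C u a v" | "a \<noteq> u" "b \<noteq> u" "\<not> cyc C u a v"
      by blast
    then show ?thesis
    proof cases
      case 1
      then show ?thesis using ab ne by (simp add: f_def)
    next
      case 2
      then have "\<not> cyc C u a v" using ab rot asym by blast
      then show ?thesis using 2 ne small[of a] x by (simp add: f_def)
    next
      case 3
      have uab: "cyc C u a b" and "cyc C u b v"
        using tr[of v u a b] tr[of v u a b] 3(3) ab rot by (meson asym tr)+
      then show ?thesis
        using 3 ne interval_card_less(1)[OF C uab] by (simp add: f_def)
    next
      \<comment> \<open>Here a belongs to the first block; b is either counted from v as well or
        placed beyond x.\<close>
      case 4
      have "cyc C v a b" using ab rot by blast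
      from interval_card_less(1)[OF C this] show ?thesis
        using 4 ne small[of a] x by (simp add: f_def)
    qed
  qed
  have last: "f a < f v" if "a \<in> verts C" "a \<noteq> v" for a
    using small[of a] mid[of a] x y that uv by (auto simp: f_def)
  have "f ` verts C \<subseteq> {..y}" using last fv by (force simp: less_imp_le)
  moreover have "f w < card (verts C)"
    if "w \<in> verts C" "w \<noteq> u \<and> w \<noteq> v \<and> w \<notin> interval C u v" for w
    using that small[of w] by (simp add: f_def interval_def)
  ultimately show ?thesis
    using cyclic_cut[where f = f and v = v, OF V mono last uv(2)] fu fv by blast
qed

section \<open>Linear upper bound\<close>

text \<open>Any other edge within the arc from u to v, oriented along it, would span a smaller
  interval than a minimal one.\<close>

lemma shortest_edge:
  assumes C: "cyc_ordered_graph C" and "edges C \<noteq> {}"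
  obtains u v where "{u, v} \<in> edges C"
    and "\<And>a b. \<lbrakk>{a, b} \<in> edges C; {a, b} \<subseteq> {u, v} \<union> interval C u v\<rbrakk> \<Longrightarrow> {a, b} = {u, v}"
proof -
  have V: "cyclic_order_on (verts C) (cyc C)" using C by (auto simp: cyc_ordered_graph_def)
  note rot = cyclic_rot[OF V] and tot = cyclic_total[OF V]
  obtain e where e: "e \<in> edges C" using assms by blast
  then have "card e = 2" using C by (auto simp: cyc_ordered_graph_def)
  then obtain p q where "{p, q} \<in> edges C" using e by (auto simp: card_2_iff)
  \<comment> \<open>The minimum is over ordered pairs, so both arcs of every edge compete.\<close>
  then obtain u v where uv: "{u, v} \<in> edges C" and
    min: "\<And>a b. {a, b} \<in> edges C \<Longrightarrow> card (interval C u v) \<le> card (interval C a b)"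
    using ex_has_least_nat[where P = "\<lambda>(a, b). {a, b} \<in> edges C"
        and m = "\<lambda>(a, b). card (interval C a b)" and k = "(p, q)"] by auto
  have U: "{u, w} \<notin> edges C" if "w \<in> interval C u v" for w
    using interval_card_less(1)[OF C] min[of u w] that by (fastforce simp: interval_def)
  have W: "{w, v} \<notin> edges C" if "w \<in> interval C u v" for w
    using interval_card_less(2)[OF C] min[of w v] that by (fastforce simp: interval_def)
  have B': "{a, b} \<notin> edges C" if "a \<in> interval C u v" "b \<in> interval C u v" "cyc C u a b" for a b
  proof -
    \<comment> \<open>Shrink the arc twice: first its end from v to b, then its start from u to
      a.\<close>
    have "card (interval C a b) < card (interval C u v)"
      using interval_card_less(2)[OF C that(3)] interval_card_less(1)[OF C, of u b v] that
      by (simp add: interval_def)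
    then show ?thesis using min[of a b] by fastforce
  qed
  have B: "{a, b} \<notin> edges C" if ab: "a \<in> interval C u v" "b \<in> interval C u v" for a b
  proof
    assume E: "{a, b} \<in> edges C"
    have "u \<noteq> a" "u \<noteq> b" using ab cyclic_distinct[OF V] by (auto simp: interval_def)
    then have "cyc C u a b \<or> cyc C u b a"
      using tot[of u a b] rot cyc_graph_edge[OF C E] cyc_graph_edge[OF C uv] by metis
    then show False using B'[OF ab] B'[OF ab(2,1)] E by (auto simp: insert_commute)
  qed
  show thesis
  proof (rule that[OF uv])
    fix a b assume E: "{a, b} \<in> edges C" and "{a, b} \<subseteq> {u, v} \<union> interval C u v"
    then have "a = u \<or> a = v \<or> a \<in> interval C u v" "b = u \<or> b = v \<or> b \<in> interval C u v" by auto
    moreover have "a \<noteq> b" using cyc_graph_edge[OF C E] by blast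
    moreover have "{b, a} \<in> edges C" using E by (simp add: insert_commute)
    ultimately show "{a, b} = {u, v}" using E U W B by blast
  qed
qed

lemma ssat_le_linear:
  assumes C: "cyc_ordered_graph C" and "edges C \<noteq> {}"
  defines "k \<equiv> card (verts C)"
  shows "ssat n C \<le> (2 * k + 1) * n"
proof -
  obtain u v where uv: "{u, v} \<in> edges C"
    and short: "\<And>a b. \<lbrakk>{a, b} \<in> edges C; {a, b} \<subseteq> {u, v} \<union> interval C u v\<rbrakk> \<Longrightarrow> {a, b} = {u, v}"
    using shortest_edge[OF assms(1,2)] by blast
  note mem = cyc_graph_edge[OF C uv]
  \<comment> \<open>A missing pair x < y thus has \<open>k \<le> x\<close> and
    \<open>x + k < y\<close>, the room that \<open>embed_linear\<close> asks for.\<close>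
  define P where "P a b \<longleftrightarrow> a < k \<or> b \<le> a + k" for a b :: nat
  have "ssat n C \<le> card (edges (host n P))"
  proof (rule ssat_le_host[OF C])
    fix x y assume "x < y" "y < n" "\<not> P x y"
    then have x: "card (verts C) \<le> x" and y: "x + card (interval C u v) < y"
      using interval_card_less_verts[OF C mem(2), of v] by (auto simp: P_def k_def)
    obtain f where f: "f u = x" "f v = y" "inj_on f (verts C)" "f ` verts C \<subseteq> {..y}"
      "\<forall>a b c. cyc C a b c \<longrightarrow> nat_cyclic (f a) (f b) (f c)"
      and small: "\<And>w. \<lbrakk>w \<in> verts C; w \<noteq> u \<and> w \<noteq> v \<and> w \<notin> interval C u v\<rbrakk> \<Longrightarrow> f w < k"
      using embed_linear[OF C mem(2,3,1) x y] unfolding k_def by blast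
    have "P (f a) (f b)" if E: "{a, b} \<in> edges C" "{a, b} \<noteq> {u, v}" "f a < f b" for a b
    proof -
      \<comment> \<open>By the choice of uv, another edge has an end outside the arc from u to v,
        and this end is mapped to a universal vertex.\<close>
      have "f a < k \<or> f b < k"
        using short[OF E(1)] E(2) small[of a] small[of b] cyc_graph_edge[OF C E(1)] by blast
      then show ?thesis using E(3) by (auto simp: P_def)
    qed
    then show "\<exists>u v f. {u, v} \<in> edges C \<and> f u = x \<and> f v = y \<and> inj_on f (verts C) \<and>
        f ` verts C \<subseteq> {..y} \<and>
        (\<forall>a b c. cyc C a b c \<longrightarrow> nat_cyclic (f a) (f b) (f c)) \<and>
        (\<forall>a b. {a, b} \<in> edges C \<longrightarrow> {a, b} \<noteq> {u, v} \<longrightarrow> f a < f b \<longrightarrow> P (f a) (f b))"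
      using uv f by blast
  qed
  \<comment> \<open>Edges at a universal vertex are coded by their ends, the others by smaller end
    and difference: k * n plus n * (k + 1) codes.\<close>
  also have "\<dots> \<le> card ((\<lambda>(a, b). {a, b}) ` ({..<k} \<times> {..<n}) \<union>
      (\<lambda>(a, d). {a, a + d}) ` ({..<n} \<times> {..k}))"
  proof (rule card_mono)
    show "edges (host n P) \<subseteq> (\<lambda>(a, b). {a, b}) ` ({..<k} \<times> {..<n}) \<union>
      (\<lambda>(a, d). {a, a + d}) ` ({..<n} \<times> {..k})" (is "_ \<subseteq> ?A \<union> ?B")
    proof
      fix e assume "e \<in> edges (host n P)"
      then obtain a b where e: "e = {a, b}" "a < b" "b < n" "P a b" by (auto simp: host_def)
      show "e \<in> ?A \<union> ?B"
      proof (cases "a < k")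
        case True
        then have "(a, b) \<in> {..<k} \<times> {..<n}" using e by auto
        then have "(\<lambda>(a, b). {a, b}) (a, b) \<in> ?A" by (rule imageI)
        then show ?thesis using e by simp
      next
        case False
        then have "(a, b - a) \<in> {..<n} \<times> {..k}" using e by (auto simp: P_def)
        then have "(\<lambda>(a, d). {a, a + d}) (a, b - a) \<in> ?B" by (rule imageI)
        then show ?thesis using e by simp
      qed
    qed
  qed simp
  also have "\<dots> \<le> card ({..<k} \<times> {..<n}) + card ({..<n} \<times> {..k})"
    by (intro order_trans[OF card_Un_le] add_mono card_image_le) auto
  also have "\<dots> = (2 * k + 1) * n"
    by (simp add: algebra_simps)
  finally show ?thesis .
qed

section \<open>Constant upper bound from a minedge\<close>

text \<open>An end of degree one lies on no edge besides uv.\<close>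

lemma minedge_isolated:
  assumes C: "cyc_ordered_graph C" and "minedge C u v"
    and ab: "{a, b} \<in> edges C" "{a, b} \<noteq> {u, v}"
  shows "a \<noteq> u \<and> a \<noteq> v \<and> b \<noteq> u \<and> b \<noteq> v"
proof -
  have "{a, b} = {u, v}" if "p \<in> {u, v}" "p \<in> {a, b}" for p
  proof -
    have "degree C p = 1" "{u, v} \<in> edges C" using assms(2) that by (auto simp: minedge_def)
    then obtain e where "{e \<in> edges C. p \<in> e} = {e}"
      unfolding degree_def by (auto simp: card_1_singleton_iff)
    moreover have "{u, v} \<in> {e \<in> edges C. p \<in> e}" "{a, b} \<in> {e \<in> edges C. p \<in> e}"
      using ab that \<open>{u, v} \<in> edges C\<close> by auto
    ultimately show ?thesis by simp
  qed
  then show ?thesis using ab by blast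
qed

lemma minedge_sym: "minedge C u v \<Longrightarrow> minedge C v u"
  by (auto simp: minedge_def insert_commute)

text \<open>
  With \<open>I\<^bsub>u,v\<^esub>\<close> empty, the order cut at \<open>u\<close> starts with \<open>v\<close>, so the other vertices fit right after
  \<open>x\<close>. This serves the case that \<open>x\<close> is early in the clique.
\<close>

lemma embed_after:
  assumes C: "cyc_ordered_graph C" and uv: "u \<in> verts C" "v \<in> verts C" "u \<noteq> v"
    and empty: "interval C u v = {}" and y: "x + card (verts C) \<le> y"
  shows "\<exists>f. f v = x \<and> f u = y \<and> inj_on f (verts C) \<and> f ` verts C \<subseteq> {..y} \<and>
     (\<forall>a b c. cyc C a b c \<longrightarrow> nat_cyclic (f a) (f b) (f c)) \<and>
     (\<forall>w\<in>verts C. w \<noteq> u \<longrightarrow> f w < x + card (verts C))"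
proof -
  have V: "cyclic_order_on (verts C) (cyc C)" using C by (auto simp: cyc_ordered_graph_def)
  \<comment> \<open>Since \<open>interval C u v\<close> is empty, v gets the value x itself; u,
    where the order is cut, comes last.\<close>
  define f where "f w = (if w = u then y else x + card (interval C u w))" for w
  have f: "f v = x" "f u = y" using uv empty by (auto simp: f_def)
  have small: "card (interval C u w) < card (verts C)" for w
    using interval_card_less_verts[OF C uv(1)] .
  have mono: "f a < f b" if "cyc C a b u" for a b
  proof -
    have "cyc C u a b" using that cyclic_rot[OF V] by blast
    from interval_card_less(1)[OF C this] show ?thesis
      using cyclic_distinct[OF V that] by (simp add: f_def)
  qed
  have last: "f a < f u" if "a \<in> verts C" "a \<noteq> u" for a
    using small[of a] y that by (simp add: f_def)
  have "f ` verts C \<subseteq> {..y}" using last f by (force simp: less_imp_le)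
  moreover have "f w < x + card (verts C)" if "w \<noteq> u" for w
    using small[of w] that by (simp add: f_def)
  ultimately show ?thesis
    using cyclic_cut[where f = f and v = u, OF V mono last uv(1)] f by blast
qed

lemma ssat_le_const:
  assumes C: "cyc_ordered_graph C" and min: "minedge C u v" and empty: "interval C u v = {}"
  defines "k \<equiv> card (verts C)"
  shows "ssat n C \<le> 2 ^ (2 * k)"
proof -
  have uv: "{u, v} \<in> edges C" using min by (simp add: minedge_def)
  then have vu: "{v, u} \<in> edges C" by (simp add: insert_commute)
  note mem = cyc_graph_edge[OF C uv]
  define P where "P a b \<longleftrightarrow> b < 2 * k" for a b :: nat
  have "ssat n C \<le> card (edges (host n P))"
  proof (rule ssat_le_host[OF C])
    fix x y assume "x < y" "y < n" "\<not> P x y"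
    then have xy: "x < y" "2 * k \<le> y" by (auto simp: P_def)
    obtain p q f where pq: "{p, q} = {u, v}" "f p = x" "f q = y" "inj_on f (verts C)"
      "f ` verts C \<subseteq> {..y}" "\<forall>a b c. cyc C a b c \<longrightarrow> nat_cyclic (f a) (f b) (f c)"
      and small: "\<And>w. \<lbrakk>w \<in> verts C; w \<noteq> u; w \<noteq> v\<rbrakk> \<Longrightarrow> f w < 2 * k"
    \<comment> \<open>For x < k the other vertices fit after x and below 2 * k, with v sent to x and
      u to y; otherwise they fit among the first k vertices, before x. The names p, q cover both
      orientations.\<close>
    proof (cases "x < k")
      case True
      then have "x + card (verts C) \<le> y" using xy by (simp add: k_def)
      from embed_after[OF C mem(2,3,1) empty this]
      obtain f where f: "f v = x" "f u = y" "inj_on f (verts C)" "f ` verts C \<subseteq> {..y}"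
          "\<forall>a b c. cyc C a b c \<longrightarrow> nat_cyclic (f a) (f b) (f c)"
        and less: "\<forall>w\<in>verts C. w \<noteq> u \<longrightarrow> f w < x + card (verts C)"
        by (elim exE conjE) (rule that)
      have "f w < 2 * k" if "w \<in> verts C" "w \<noteq> u" for w
        using less True that unfolding k_def by fastforce
      then show thesis by (intro that[OF insert_commute f]) auto
    next
      case False
      then have "card (verts C) \<le> x" "x + card (interval C u v) < y"
        using xy empty by (auto simp: k_def)
      from embed_linear[OF C mem(2,3,1) this]
      obtain f where f: "f u = x" "f v = y" "inj_on f (verts C)" "f ` verts C \<subseteq> {..y}"
          "\<forall>a b c. cyc C a b c \<longrightarrow> nat_cyclic (f a) (f b) (f c)"
        and less: "\<forall>w\<in>verts C. w \<noteq> u \<and> w \<noteq> v \<and> w \<notin> interval C u v \<longrightarrow> f w < card (verts C)"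
        by (elim exE conjE) (rule that)
      have "f w < 2 * k" if "w \<in> verts C" "w \<noteq> u" "w \<noteq> v" for w
        using less empty that unfolding k_def by fastforce
      then show thesis by (intro that[OF refl f]) auto
    qed
    have "P (f a) (f b)" if E: "{a, b} \<in> edges C" "{a, b} \<noteq> {p, q}" for a b
    proof -
      \<comment> \<open>Every other edge avoids u and v, so both its ends land in the
        clique.\<close>
      have "b \<noteq> u \<and> b \<noteq> v" using minedge_isolated[OF C min E(1)] E(2) pq(1) by simp
      then show ?thesis using small[of b] cyc_graph_edge[OF C E(1)] by (simp add: P_def)
    qed
    moreover have "{p, q} \<in> edges C" using uv pq(1) by simp
    ultimately show "\<exists>u v f. {u, v} \<in> edges C \<and> f u = x \<and> f v = y \<and> inj_on f (verts C) \<and>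
        f ` verts C \<subseteq> {..y} \<and>
        (\<forall>a b c. cyc C a b c \<longrightarrow> nat_cyclic (f a) (f b) (f c)) \<and>
        (\<forall>a b. {a, b} \<in> edges C \<longrightarrow> {a, b} \<noteq> {u, v} \<longrightarrow> f a < f b \<longrightarrow> P (f a) (f b))"
      using pq(2-) by (intro exI[of _ p] exI[of _ q] exI[of _ f] conjI) simp_all
  qed
  \<comment> \<open>Counting all subsets of the clique is crude, but the bound is independent of
    n.\<close>
  also have "\<dots> \<le> card (Pow {..<2 * k})"
    by (rule card_mono) (auto simp: host_def P_def)
  also have "\<dots> = 2 ^ (2 * k)" by (simp add: card_Pow)
  finally show ?thesis .
qed

section \<open>Asymptotic form of the bounds\<close>

theorem theorem10:
  fixes C :: "'a cograph"
  assumes "cyc_ordered_graph C" and "edges C \<noteq> {}"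
  shows "((\<exists>u v. minedge C u v) \<longrightarrow> (\<lambda>n. real (ssat n C)) \<in> O(\<lambda>n. 1)) \<and>
         (\<not> (\<exists>u v. minedge C u v) \<longrightarrow> (\<lambda>n. real (ssat n C)) \<in> \<Theta>(\<lambda>n. real n))"
proof (intro conjI impI)
  let ?k = "card (verts C)"
  assume "\<exists>u v. minedge C u v"
  \<comment> \<open>If only \<open>interval C v u\<close> is empty, exchange u and v.\<close>
  then obtain u v where "minedge C u v" "interval C u v = {}"
    using minedge_sym minedge_def by metis
  then have "real (ssat n C) \<le> 2 ^ (2 * ?k)" for n
    using ssat_le_const[OF assms(1)] of_nat_mono[of "ssat n C" "2 ^ (2 * ?k)"] by simp
  then show "(\<lambda>n. real (ssat n C)) \<in> O(\<lambda>n. 1)"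
    by (intro bigoI[where c = "2 ^ (2 * ?k)"]) auto
next
  let ?k = "card (verts C)"
  assume no: "\<not> (\<exists>u v. minedge C u v)"
  have upper: "real (ssat n C) \<le> real (2 * ?k + 1) * real n" for n
    using ssat_le_linear[OF assms, of n] by (metis of_nat_le_iff of_nat_mult)
  have lower: "real n \<le> 4 * real (ssat n C)" if n: "n \<ge> 2" for n
  proof -
    obtain H :: "nat cograph" where H: "cyc_ordered_graph H" "card (verts H) = n"
      "semisaturates H C" "card (edges H) = ssat n C"
      using ssat_attained by blast
    then have "n \<le> 4 * ssat n C"
      using no_minedge_card_verts_le[OF assms(1) no H(1,3)] n by simp
    then show ?thesis by linarith
  qed
  show "(\<lambda>n. real (ssat n C)) \<in> \<Theta>(\<lambda>n. real n)"
  proof (rule bigthetaI)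
    show "(\<lambda>n. real (ssat n C)) \<in> O(\<lambda>n. real n)"
      using upper by (intro bigoI[where c = "real (2 * ?k + 1)"]) auto
    show "(\<lambda>n. real (ssat n C)) \<in> \<Omega>(\<lambda>n. real n)"
      unfolding bigomega_iff_bigo using lower
      by (intro bigoI[where c = 4]) (auto simp: eventually_at_top_linorder)
  qed
qed

end
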